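(* Let $K$ be an edge-path connected simplicial complex, let $v_0$ be a vertex of $K$, and let $K^2=K\prod K$ be the categorical product. Let $i_1,i_2\colon K\to K^2$ be the simplicial maps given on vertices by $i_1(v)=(v,v_0)$ and $i_2(v)=(v_0,v)$. Then $\mathrm{scat}(K)=\mathrm{SD}(i_1,i_2)$.
   Context: A simplicial complex means an abstract simplicial complex: a collection of finite nonempty subsets (simplices) of a vertex set, containing all singletons and closed under taking nonempty subsets. All complexes are assumed edge-path connected (the subcomplexes appearing in coverings are not required to be), and all maps are simplicial. Two simplicial maps $\varphi,\psi\colon K\to K'$ are contiguous, $\varphi\sim_c\psi$, if $\varphi(\sigma)\cup\psi(\sigma)$ is a simplex of $K'$ for every simplex $\sigma$ of $K$. They are in the same contiguity class, $\varphi\sim\psi$, if there is a finite sequence of simplicial maps $\varphi=\varphi_1\sim_c\varphi_2\sim_c\cdots\sim_c\varphi_m=\psi$ from $K$ to $K'$. The contiguity distance $\mathrm{SD}(\varphi,\psi)$ is the least integer $n\ge 0$ such that $K$ is covered by subcomplexes $K_0,\dots,K_n$ with $\varphi|_{K_j}\sim\psi|_{K_j}$ (as maps $K_j\to K'$) for all $j$ (and $\infty$ if there is no such $n$). A subcomplex $L\subseteq K$ is categorical if there is a vertex $v$ of $K$ such that the inclusion $L\hookrightarrow K$ and the constant map $c_v\colon L\to K$ are in the same contiguity class; $\mathrm{scat}(K)$ is the least integer $n\ge 0$ such that $K$ is covered by $n+1$ categorical subcomplexes (and $\infty$ if there is none). The categorical product $K\prod K'$ is the simplicial complex whose vertices are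 pairs $(v,w)$ with $v$ a vertex of $K$ and $w$ a vertex of $K'$, such that the two projections are simplicial and universal with this property; explicitly, a finite nonempty set of pairs is a simplex if and only if its two projections are simplices of $K$ and $K'$. *)

theory Defs
  imports Main "HOL-Library.Extended_Nat"
begin

(* A complex is represented by its set of simplices alone.  As every singleton of a vertex
   is a simplex, the vertex set is recovered as the union of the simplices. *)

definition simplicial_complex :: "'a set set \<Rightarrow> bool" where
  "simplicial_complex K \<longleftrightarrow>
     (\<forall>\<sigma>\<in>K. finite \<sigma> \<and> \<sigma> \<noteq> {}) \<and>
     (\<forall>\<sigma>\<in>K. \<forall>\<tau>. \<tau> \<subseteq> \<sigma> \<longrightarrow> \<tau> \<noteq> {} \<longrightarrow> \<tau> \<in> K)"

definition vertices :: "'a set set \<Rightarrow> 'a set" where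
  "vertices K = \<Union>K"

lemma face_simplex:
  assumes "simplicial_complex K" "\<sigma> \<in> K" "\<tau> \<subseteq> \<sigma>" "\<tau> \<noteq> {}"
  shows "\<tau> \<in> K"
  using assms(1)[unfolded simplicial_complex_def, THEN conjunct2, rule_format, OF assms(2-4)] .

lemma singleton_simplex:
  assumes "simplicial_complex K" "v \<in> vertices K"
  shows "{v} \<in> K"
proof -
  from assms(2) obtain \<sigma> where "\<sigma> \<in> K" "v \<in> \<sigma>"
    by (auto simp: vertices_def)
  then show ?thesis
    using face_simplex[OF assms(1)] by simp
qed

definition subcomplex :: "'a set set \<Rightarrow> 'a set set \<Rightarrow> bool" where
  "subcomplex L K \<longleftrightarrow> simplicial_complex L \<and> L \<subseteq> K"

definition edge_path_connected :: "'a set set \<Rightarrow> bool" where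
  "edge_path_connected K \<longleftrightarrow>
     (\<forall>x\<in>vertices K. \<forall>y\<in>vertices K. (\<lambda>u w. {u, w} \<in> K)\<^sup>*\<^sup>* x y)"

(* Simplicial maps are total functions on the vertex type; only their values on vertices of the
   domain matter.  Accordingly, the restriction of a map to a subcomplex L is the same
   function, considered with domain L, and inclusions are the identity function. *)

definition simplicial_map :: "'a set set \<Rightarrow> 'b set set \<Rightarrow> ('a \<Rightarrow> 'b) \<Rightarrow> bool" where
  "simplicial_map K K' f \<longleftrightarrow> (\<forall>\<sigma>\<in>K. f ` \<sigma> \<in> K')"

definition contiguous :: "'a set set \<Rightarrow> 'b set set \<Rightarrow> ('a \<Rightarrow> 'b) \<Rightarrow> ('a \<Rightarrow> 'b) \<Rightarrow> bool" where
  "contiguous K K' f g \<longleftrightarrow>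
     simplicial_map K K' f \<and> simplicial_map K K' g \<and> (\<forall>\<sigma>\<in>K. f ` \<sigma> \<union> g ` \<sigma> \<in> K')"

definition same_contiguity_class ::
    "'a set set \<Rightarrow> 'b set set \<Rightarrow> ('a \<Rightarrow> 'b) \<Rightarrow> ('a \<Rightarrow> 'b) \<Rightarrow> bool" where
  "same_contiguity_class K K' f g \<longleftrightarrow>
     simplicial_map K K' f \<and> simplicial_map K K' g \<and> (contiguous K K')\<^sup>*\<^sup>* f g"

(* Functions agreeing on the vertices represent the same map, and are not distinguished. *)
lemma same_contiguity_class_cong_vertices:
  assumes "simplicial_map K K' f" and eq: "\<And>v. v \<in> vertices K \<Longrightarrow> f v = g v"
  shows "same_contiguity_class K K' f g"
proof -
  have im: "f ` \<sigma> = g ` \<sigma>" if "\<sigma> \<in> K" for \<sigma>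
    using that eq by (intro image_cong) (auto simp: vertices_def)
  with assms(1) have "contiguous K K' f g"
    by (simp add: contiguous_def simplicial_map_def)
  then show ?thesis
    by (auto simp: same_contiguity_class_def contiguous_def)
qed

definition covered_by :: "'a set set \<Rightarrow> nat \<Rightarrow> (nat \<Rightarrow> 'a set set) \<Rightarrow> bool" where
  "covered_by K n C \<longleftrightarrow> (\<forall>j\<le>n. subcomplex (C j) K) \<and> K = (\<Union>j\<le>n. C j)"

(* In enat, the infimum of a nonempty set is its least element, and Inf {} is infinity. *)

definition SD :: "'a set set \<Rightarrow> 'b set set \<Rightarrow> ('a \<Rightarrow> 'b) \<Rightarrow> ('a \<Rightarrow> 'b) \<Rightarrow> enat" where
  "SD K K' f g =
     Inf {enat n | n. \<exists>C. covered_by K n C \<and> (\<forall>j\<le>n. same_contiguity_class (C j) K' f g)}"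

definition categorical :: "'a set set \<Rightarrow> 'a set set \<Rightarrow> bool" where
  "categorical K L \<longleftrightarrow>
     subcomplex L K \<and> (\<exists>v\<in>vertices K. same_contiguity_class L K (\<lambda>x. x) (\<lambda>x. v))"

definition scat :: "'a set set \<Rightarrow> enat" where
  "scat K = Inf {enat n | n. \<exists>C. covered_by K n C \<and> (\<forall>j\<le>n. categorical K (C j))}"

definition categorical_product :: "'a set set \<Rightarrow> 'b set set \<Rightarrow> ('a \<times> 'b) set set" where
  "categorical_product K K' = {s. finite s \<and> s \<noteq> {} \<and> fst ` s \<in> K \<and> snd ` s \<in> K'}"

lemma simplicial_complex_categorical_product:
  assumes "simplicial_complex K" "simplicial_complex K'"
  shows "simplicial_complex (categorical_product K K')"
  unfolding simplicial_complex_def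
proof (intro conjI ballI allI impI)
  fix s t assume s: "s \<in> categorical_product K K'" and t: "t \<subseteq> s" "t \<noteq> {}"
  have "fst ` t \<subseteq> fst ` s" "snd ` t \<subseteq> snd ` s" "finite t"
    using s t by (auto simp: categorical_product_def intro: finite_subset)
  moreover have "fst ` s \<in> K" "snd ` s \<in> K'" "fst ` t \<noteq> {}" "snd ` t \<noteq> {}"
    using s t by (simp_all add: categorical_product_def)
  ultimately have "fst ` t \<in> K" "snd ` t \<in> K'"
    using face_simplex[OF assms(1), of "fst ` s" "fst ` t"]
      face_simplex[OF assms(2), of "snd ` s" "snd ` t"] by simp_all
  with \<open>finite t\<close> t show "t \<in> categorical_product K K'"
    by (simp add: categorical_product_def)
qed (auto simp: categorical_product_def)

lemma vertices_categorical_product: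
  assumes "simplicial_complex K" "simplicial_complex K'"
  shows "vertices (categorical_product K K') = vertices K \<times> vertices K'"
proof
  show "vertices (categorical_product K K') \<subseteq> vertices K \<times> vertices K'"
  proof
    fix p assume "p \<in> vertices (categorical_product K K')"
    then obtain s where "p \<in> s" "fst ` s \<in> K" "snd ` s \<in> K'"
      by (auto simp: vertices_def categorical_product_def)
    then have "fst p \<in> vertices K" "snd p \<in> vertices K'"
      unfolding vertices_def by (meson UnionI imageI)+
    then show "p \<in> vertices K \<times> vertices K'"
      by (simp add: mem_Times_iff)
  qed
  show "vertices K \<times> vertices K' \<subseteq> vertices (categorical_product K K')"
  proof
    fix p assume "p \<in> vertices K \<times> vertices K'"
    then have "{p} \<in> categorical_product K K'"
      using assms by (auto simp: categorical_product_def intro: singleton_simplex)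
    then show "p \<in> vertices (categorical_product K K')"
      unfolding vertices_def by blast
  qed
qed

lemma simplicial_map_axes:
  assumes K: "simplicial_complex K" and v0: "v0 \<in> vertices K"
  shows "simplicial_map K (categorical_product K K) (\<lambda>v. (v, v0))"
    and "simplicial_map K (categorical_product K K) (\<lambda>v. (v0, v))"
proof -
  have "(\<lambda>v. (v, v0)) ` \<sigma> \<in> categorical_product K K \<and> (\<lambda>v. (v0, v)) ` \<sigma> \<in> categorical_product K K"
    if "\<sigma> \<in> K" for \<sigma>
  proof -
    have "finite \<sigma>" "\<sigma> \<noteq> {}"
      using K that by (simp_all add: simplicial_complex_def)
    with singleton_simplex[OF K v0] that show ?thesis
      by (simp add: categorical_product_def image_image image_constant_conv)
  qed
  then show "simplicial_map K (categorical_product K K) (\<lambda>v. (v, v0))"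
    and "simplicial_map K (categorical_product K K) (\<lambda>v. (v0, v))"
    by (simp_all add: simplicial_map_def)
qed

end

theory Submission imports Defs begin

(* The two axes i1, i2 are compared through the projection fst in one direction. In the other,
   connectedness lets any contraction of a subcomplex end at v0; pushing that contraction along
   i1 and along i2 joins both axes to the constant map at (v0, v0). *)

lemma contiguous_sym: "contiguous K K' f g \<Longrightarrow> contiguous K K' g f"
  by (simp add: contiguous_def Un_commute)

lemma simplicial_map_comp:
  assumes "simplicial_map K' M h" "simplicial_map K K' f"
  shows "simplicial_map K M (\<lambda>x. h (f x))"
  using assms unfolding simplicial_map_def by (metis image_image)

text \<open>Images commute with unions, so \<open>h\<close> carries the simplex of \<open>K'\<close>
  spanned by both images of a simplex onto the one required in \<open>M\<close>.\<close>

lemma contiguous_comp: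
  assumes "simplicial_map K' M h" "contiguous K K' f g"
  shows "contiguous K M (\<lambda>x. h (f x)) (\<lambda>x. h (g x))"
proof -
  have "h ` (f ` \<sigma> \<union> g ` \<sigma>) \<in> M" if "\<sigma> \<in> K" for \<sigma>
    using assms that by (simp add: contiguous_def simplicial_map_def)
  then show ?thesis
    using assms by (simp add: contiguous_def simplicial_map_comp image_Un image_image)
qed

lemma same_contiguity_class_sym:
  assumes "same_contiguity_class K K' f g"
  shows "same_contiguity_class K K' g f"
proof -
  have "symp (contiguous K K')"
    by (auto intro: sympI contiguous_sym)
  then have "symp (contiguous K K')\<^sup>*\<^sup>*"
    by (rule symp_rtranclp)
  then show ?thesis
    using assms by (auto simp: same_contiguity_class_def dest: sympD)
qed

lemma same_contiguity_class_trans: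
  "same_contiguity_class K K' f g \<Longrightarrow> same_contiguity_class K K' g h
    \<Longrightarrow> same_contiguity_class K K' f h"
  by (auto simp: same_contiguity_class_def)

text \<open>A chain of contiguities is pushed forward along \<open>h\<close> term by term. It is
  applied with \<open>h\<close> each of the two axes, and with \<open>h\<close> the projection
  \<open>fst\<close>.\<close>

lemma same_contiguity_class_comp:
  assumes h: "simplicial_map K' M h" and fg: "same_contiguity_class K K' f g"
  shows "same_contiguity_class K M (\<lambda>x. h (f x)) (\<lambda>x. h (g x))"
proof -
  have "(contiguous K K')\<^sup>*\<^sup>* f g"
    using fg by (simp add: same_contiguity_class_def)
  then have "(contiguous K M)\<^sup>*\<^sup>* (\<lambda>x. h (f x)) (\<lambda>x. h (g x))"
    by induction (simp, erule rtranclp.rtrancl_into_rtrancl, erule contiguous_comp[OF h])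
  moreover have "simplicial_map K M (\<lambda>x. h (f x))" "simplicial_map K M (\<lambda>x. h (g x))"
    using h fg by (simp_all add: same_contiguity_class_def simplicial_map_comp)
  ultimately show ?thesis
    by (simp add: same_contiguity_class_def)
qed

lemma simplicial_map_const:
  assumes "simplicial_complex L" "simplicial_complex K" "v \<in> vertices K"
  shows "simplicial_map L K (\<lambda>x. v)"
  using assms(1) singleton_simplex[OF assms(2,3)]
  by (simp add: simplicial_map_def simplicial_complex_def image_constant_conv)

text \<open>Simplices of \<open>L\<close> are nonempty, so the two images of any of them are exactly
  \<open>{u}\<close> and \<open>{w}\<close>, and their union is the given edge.\<close>

lemma contiguous_const_edge:
  assumes L: "simplicial_complex L" and K: "simplicial_complex K" and "{u, w} \<in> K"
  shows "contiguous L K (\<lambda>x. u) (\<lambda>x. w)"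
proof -
  have "u \<in> vertices K" "w \<in> vertices K"
    using assms by (auto simp: vertices_def)
  moreover have "\<sigma> \<noteq> {}" if "\<sigma> \<in> L" for \<sigma>
    using L that by (simp add: simplicial_complex_def)
  ultimately show ?thesis
    using assms
    by (simp add: contiguous_def simplicial_map_const image_constant_conv insert_commute[of w u])
qed

text \<open>Each edge of a path in \<open>K\<close> from \<open>u\<close> to \<open>w\<close>
  contributes one contiguity. Connectedness is asked of the target only, so this applies to
  disconnected members of a cover.\<close>

lemma same_contiguity_class_const:
  assumes L: "simplicial_complex L" and K: "simplicial_complex K"
    and "edge_path_connected K" "u \<in> vertices K" "w \<in> vertices K"
  shows "same_contiguity_class L K (\<lambda>x. u) (\<lambda>x. w)"
proof -
  have "(\<lambda>u w. {u, w} \<in> K)\<^sup>*\<^sup>* u w"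
    using assms by (simp add: edge_path_connected_def)
  then have "(contiguous L K)\<^sup>*\<^sup>* (\<lambda>x. u) (\<lambda>x. w)"
    by induction (simp, erule rtranclp.rtrancl_into_rtrancl, erule contiguous_const_edge[OF L K])
  then show ?thesis
    using assms by (simp add: same_contiguity_class_def simplicial_map_const)
qed

lemma simplicial_map_fst: "simplicial_map (categorical_product K K') K fst"
  by (simp add: simplicial_map_def categorical_product_def)

text \<open>The comparison is made for one subcomplex at a time, so that the very same covers serve
  for \<open>scat\<close> and for \<open>SD\<close>.\<close>

lemma categorical_iff_same_contiguity_class_axes:
  assumes K: "simplicial_complex K" and conn: "edge_path_connected K"
    and v0: "v0 \<in> vertices K" and L: "subcomplex L K"
  shows "categorical K L \<longleftrightarrow>
    same_contiguity_class L (categorical_product K K) (\<lambda>v. (v, v0)) (\<lambda>v. (v0, v))"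
proof
  assume "categorical K L"
  then obtain v where v: "v \<in> vertices K" "same_contiguity_class L K (\<lambda>x. x) (\<lambda>x. v)"
    by (auto simp: categorical_def)
  have "simplicial_complex L"
    using L by (simp add: subcomplex_def)
  from same_contiguity_class_const[OF this K conn v(1) v0]
  have c: "same_contiguity_class L K (\<lambda>x. x) (\<lambda>x. v0)"
    by (rule same_contiguity_class_trans[OF v(2)])
  show "same_contiguity_class L (categorical_product K K) (\<lambda>v. (v, v0)) (\<lambda>v. (v0, v))"
    \<comment> \<open>Both axes send the constant map at \<open>v0\<close> to the constant map at
      \<open>(v0, v0)\<close>; there the first chain meets the reversed second one.\<close>
    using same_contiguity_class_comp[OF simplicial_map_axes(1)[OF K v0] c]
      same_contiguity_class_comp[OF simplicial_map_axes(2)[OF K v0] c,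
        THEN same_contiguity_class_sym]
    by (rule same_contiguity_class_trans)
next
  assume "same_contiguity_class L (categorical_product K K) (\<lambda>v. (v, v0)) (\<lambda>v. (v0, v))"
  \<comment> \<open>Followed by \<open>fst\<close>, the first axis becomes the inclusion of
    \<open>L\<close> and the second the constant map at \<open>v0\<close>.\<close>
  from same_contiguity_class_comp[OF simplicial_map_fst this]
  have "same_contiguity_class L K (\<lambda>x. x) (\<lambda>x. v0)"
    by simp
  then show "categorical K L"
    using L v0 unfolding categorical_def by blast
qed

theorem theorem3:
  fixes K :: "'a set set" and v0 :: 'a
  assumes "simplicial_complex K"
    and "edge_path_connected K"
    and "v0 \<in> vertices K"
  shows "scat K = SD K (categorical_product K K) (\<lambda>v. (v, v0)) (\<lambda>v. (v0, v))"
proof -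
  \<comment> \<open>With the same \<open>n\<close> and \<open>C\<close> admissible on both sides,
    the two infima are taken over one set, which also settles the case of value infinity.\<close>
  have "(covered_by K n C \<and> (\<forall>j\<le>n. categorical K (C j))) \<longleftrightarrow>
    (covered_by K n C \<and> (\<forall>j\<le>n. same_contiguity_class (C j) (categorical_product K K)
      (\<lambda>v. (v, v0)) (\<lambda>v. (v0, v))))" for n C
    using categorical_iff_same_contiguity_class_axes[OF assms] by (auto simp: covered_by_def)
  then show ?thesis
    by (simp add: scat_def SD_def)
qed

end
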